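(* Let $(X_1,d_1)$ and $(X_2,d_2)$ be complete $\mathrm{CAT}(0)$ spaces and $\Phi:X_1\to X_2$ an isometry. Then for any $S\subseteq X_1$ one has $\Phi(\operatorname{thr}S)=\operatorname{thr}\Phi(S)$ and, in particular, $\Phi(\operatorname{cl}\operatorname{co}S)=\operatorname{cl}\operatorname{co}\Phi(S)$.
   Context: A $\mathrm{CAT}(0)$ space is a geodesic metric space in which every geodesic triangle is at least as thin as its Euclidean comparison triangle; it is uniquely geodesic, and $[x,y]$ denotes the geodesic segment joining $x$ and $y$. A set $C$ is convex if $[x,y]\subseteq C$ for all $x,y\in C$; $\operatorname{co}S$ is the smallest convex set containing $S$, and $\operatorname{cl}$ denotes closure. The threading of a set $S$ is $\operatorname{thr}S:=\bigcup_{x,y\in S}[x,y]$. An isometry is a map with $d_2(\Phi(x),\Phi(y))=d_1(x,y)$ for all $x,y\in X_1$. *)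

theory Defs
  imports "HOL-Analysis.Analysis"
begin

context Metric_space
begin

definition geodesic_path :: "(real \<Rightarrow> 'a) \<Rightarrow> 'a \<Rightarrow> 'a \<Rightarrow> bool" where
  "geodesic_path c x y \<longleftrightarrow>
     c ` {0..d x y} \<subseteq> M \<and> c 0 = x \<and> c (d x y) = y \<and>
     (\<forall>s\<in>{0..d x y}. \<forall>t\<in>{0..d x y}. d (c s) (c t) = \<bar>s - t\<bar>)"

definition is_geodesic_segment :: "'a set \<Rightarrow> 'a \<Rightarrow> 'a \<Rightarrow> bool" where
  "is_geodesic_segment G x y \<longleftrightarrow> (\<exists>c. geodesic_path c x y \<and> G = c ` {0..d x y})"

definition geodesic_space :: bool where
  "geodesic_space \<longleftrightarrow> (\<forall>x\<in>M. \<forall>y\<in>M. \<exists>G. is_geodesic_segment G x y)"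

definition geodesic_triangle ::
    "'a \<Rightarrow> 'a \<Rightarrow> 'a \<Rightarrow> 'a set \<Rightarrow> 'a set \<Rightarrow> 'a set \<Rightarrow> bool" where
  "geodesic_triangle x y z A B C \<longleftrightarrow>
     is_geodesic_segment A x y \<and> is_geodesic_segment B y z \<and> is_geodesic_segment C z x"

definition comparison_triangle ::
    "'a \<Rightarrow> 'a \<Rightarrow> 'a \<Rightarrow> real^2 \<Rightarrow> real^2 \<Rightarrow> real^2 \<Rightarrow> bool" where
  "comparison_triangle x y z x' y' z' \<longleftrightarrow>
     dist x' y' = d x y \<and> dist y' z' = d y z \<and> dist z' x' = d z x"

definition comparison_point ::
    "'a set \<Rightarrow> 'a \<Rightarrow> real^2 \<Rightarrow> real^2 \<Rightarrow> 'a \<Rightarrow> real^2 \<Rightarrow> bool" where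
  "comparison_point A x x' y' p p' \<longleftrightarrow>
     p \<in> A \<and> p' \<in> closed_segment x' y' \<and> dist x' p' = d x p"

text \<open>
  Comparison triangles always exist and are unique up to isometries of the plane, so
  quantifying universally over them below is equivalent to fixing one.
\<close>

definition thin_triangle ::
    "'a \<Rightarrow> 'a \<Rightarrow> 'a \<Rightarrow> 'a set \<Rightarrow> 'a set \<Rightarrow> 'a set \<Rightarrow> bool" where
  "thin_triangle x y z A B C \<longleftrightarrow>
     (\<forall>x' y' z'. comparison_triangle x y z x' y' z' \<longrightarrow>
        (let comp = (\<lambda>p p'. comparison_point A x x' y' p p' \<or>
                            comparison_point B y y' z' p p' \<or>
                            comparison_point C z z' x' p p')
         in \<forall>p p' q q'. comp p p' \<and> comp q q' \<longrightarrow> d p q \<le> dist p' q'))"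

definition segment :: "'a \<Rightarrow> 'a \<Rightarrow> 'a set" where
  "segment x y = (THE G. is_geodesic_segment G x y)"

definition geod_convex :: "'a set \<Rightarrow> bool" where
  "geod_convex C \<longleftrightarrow> C \<subseteq> M \<and> (\<forall>x\<in>C. \<forall>y\<in>C. segment x y \<subseteq> C)"

definition co :: "'a set \<Rightarrow> 'a set" where
  "co S = geod_convex hull S"

definition thr :: "'a set \<Rightarrow> 'a set" where
  "thr S = (\<Union>x\<in>S. \<Union>y\<in>S. segment x y)"

end

locale CAT0_space = Metric_space +
  assumes geodesic: geodesic_space
    and thin: "geodesic_triangle x y z A B C \<Longrightarrow> thin_triangle x y z A B C"

definition isometry_map ::
    "'a set \<Rightarrow> ('a \<Rightarrow> 'a \<Rightarrow> real) \<Rightarrow> 'b set \<Rightarrow> ('b \<Rightarrow> 'b \<Rightarrow> real) \<Rightarrow> ('a \<Rightarrow> 'b) \<Rightarrow> bool" where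
  "isometry_map X1 d1 X2 d2 f \<longleftrightarrow>
     f ` X1 \<subseteq> X2 \<and> (\<forall>x\<in>X1. \<forall>y\<in>X1. d2 (f x) (f y) = d1 x y)"

lemma (in Metric_space) geodesic_pathD:
  assumes "geodesic_path c x y"
  shows "c 0 = x" "c (d x y) = y" "x \<in> M" "y \<in> M"
    and "\<And>t. t \<in> {0..d x y} \<Longrightarrow> c t \<in> M"
    and "\<And>s t. s \<in> {0..d x y} \<Longrightarrow> t \<in> {0..d x y} \<Longrightarrow> d (c s) (c t) = \<bar>s - t\<bar>"
proof -
  show 0: "c 0 = x" and 1: "c (d x y) = y"
    using assms by (simp_all only: geodesic_path_def)
  have im: "c ` {0..d x y} \<subseteq> M"
    using assms by (simp only: geodesic_path_def)
  show M: "c t \<in> M" if "t \<in> {0..d x y}" for t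
    using im that by (rule subsetD[OF _ imageI])
  show "x \<in> M" using M[of 0] unfolding 0 by simp
  show "y \<in> M" using M[of "d x y"] unfolding 1 by simp
  show "d (c s) (c t) = \<bar>s - t\<bar>" if "s \<in> {0..d x y}" "t \<in> {0..d x y}" for s t
    using assms that by (simp only: geodesic_path_def)
qed

lemma (in Metric_space) is_geodesic_segment_sym:
  assumes "is_geodesic_segment G x y"
  shows "is_geodesic_segment G y x"
proof -
  obtain c where c: "geodesic_path c x y" "G = c ` {0..d x y}"
    using assms unfolding is_geodesic_segment_def by blast
  let ?r = "\<lambda>t. d x y - t"
  have im: "(\<lambda>t. c (?r t)) ` {0..d x y} = c ` {0..d x y}"
  proof -
    have "?r ` {0..d x y} = {0..d x y}"
      by (auto simp: image_iff intro!: bexI[where x = "d x y - _"])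
    then show ?thesis by (metis image_image)
  qed
  have "geodesic_path (\<lambda>t. c (?r t)) y x"
    using c(1) unfolding geodesic_path_def commute[of y x] im by auto
  then show ?thesis
    unfolding is_geodesic_segment_def using c(2) im commute[of y x] by metis
qed

lemma (in CAT0_space) segment_subset:
  assumes A: "is_geodesic_segment A x y" and B: "is_geodesic_segment B x y"
  shows "A \<subseteq> B"
proof
  fix p assume p: "p \<in> A"
  obtain a where a: "geodesic_path a x y" "A = a ` {0..d x y}"
    using A unfolding is_geodesic_segment_def by blast
  obtain b where b: "geodesic_path b x y" "B = b ` {0..d x y}"
    using B unfolding is_geodesic_segment_def by blast
  have xy: "x \<in> M" "y \<in> M" using geodesic_pathD(3,4)[OF a(1)] .
  obtain s where s: "s \<in> {0..d x y}" "p = a s" using p a(2) by blast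
  define q where "q = b s"
  have q: "q \<in> B" using b(2) s q_def by blast
  have pq: "p \<in> M" "q \<in> M"
    using geodesic_pathD(5)[OF a(1) s(1)] geodesic_pathD(5)[OF b(1) s(1)]
    by (simp_all add: s(2) q_def)
  have "is_geodesic_segment {y} y y"
    unfolding is_geodesic_segment_def geodesic_path_def using xy
    by (intro exI[of _ "\<lambda>_. y"]) auto
  then have "geodesic_triangle x y y A {y} B"
    unfolding geodesic_triangle_def using A B is_geodesic_segment_sym by blast
  then have thin: "thin_triangle x y y A {y} B" by (rule thin)
  define y' :: "real^2" where "y' = d x y *\<^sub>R axis 1 1"
  define p' :: "real^2" where "p' = s *\<^sub>R axis 1 1"
  have n: "norm (axis 1 1 :: real^2) = 1" by simp
  have seg: "p' \<in> closed_segment 0 y'"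
  proof (cases "d x y = 0")
    case True then show ?thesis using s by (auto simp: p'_def)
  next
    case False
    then have "0 < d x y" by (simp add: less_le)
    then show ?thesis using s unfolding in_segment
      by (intro exI[of _ "s / d x y"]) (auto simp: p'_def y'_def)
  qed
  have tri: "comparison_triangle x y y 0 y' y'"
    using xy n by (auto simp: comparison_triangle_def y'_def commute)
  have dp: "d x p = s"
    using geodesic_pathD(6)[OF a(1), of 0 s] s geodesic_pathD(1)[OF a(1)] by simp
  have dq: "d y q = d x y - s"
    using geodesic_pathD(6)[OF b(1), of "d x y" s] s geodesic_pathD(2)[OF b(1)]
    by (simp add: q_def)
  have "dist y' p' = d x y - s"
  proof -
    have "dist y' p' = norm ((d x y - s) *\<^sub>R (axis 1 1 :: real^2))"
      by (simp add: dist_norm y'_def p'_def algebra_simps)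
    then show ?thesis using s n by simp
  qed
  then have cq: "comparison_point B y y' 0 q p'"
    using q dq seg by (simp add: comparison_point_def closed_segment_commute)
  have cp: "comparison_point A x 0 y' p p'"
    using p dp seg s n by (simp add: comparison_point_def p'_def)
  have "d p q \<le> dist p' p'"
    using thin tri cp cq unfolding thin_triangle_def Let_def by blast
  then have "d p q = 0" using nonneg[of p q] by simp
  then have "p = q" using pq by simp
  then show "p \<in> B" using q by simp
qed

text \<open>Since segments are unique, the definite description in \<open>segment\<close> is well defined in a CAT(0) space:\<close>

lemma (in CAT0_space) is_geodesic_segment_segment:
  assumes "x \<in> M" "y \<in> M"
  shows "is_geodesic_segment (segment x y) x y"
proof -
  obtain G where G: "is_geodesic_segment G x y"
    using geodesic assms unfolding geodesic_space_def by blast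
  show ?thesis unfolding segment_def
    by (rule theI[of _ G]) (use G segment_subset in blast)+
qed

end

theory Submission
  imports Defs
begin

text \<open>
  An isometry carries geodesic paths to geodesic paths, so by uniqueness of geodesics it maps
  \<open>[x,y]\<close> onto \<open>[\<Phi>(x),\<Phi>(y)]\<close>. Hence it commutes with threading, and both images and preimages of
  convex sets are convex, which makes it commute with the convex hull. It commutes with the closure
  because the domain is complete: if \<open>\<Phi>(a\<^sub>n)\<close> converges, then \<open>a\<^sub>n\<close> is a Cauchy sequence.
\<close>

locale metric_isometry = X1: Metric_space X1 d1 + X2: Metric_space X2 d2
  for X1 :: "'a set" and d1 :: "'a \<Rightarrow> 'a \<Rightarrow> real" and X2 :: "'b set" and d2 :: "'b \<Rightarrow> 'b \<Rightarrow> real" +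
  fixes \<Phi> :: "'a \<Rightarrow> 'b"
  assumes isometry: "isometry_map X1 d1 X2 d2 \<Phi>"
begin

lemma image_mem: "x \<in> X1 \<Longrightarrow> \<Phi> x \<in> X2"
  using isometry unfolding isometry_map_def by blast

lemma dist_image: "x \<in> X1 \<Longrightarrow> y \<in> X1 \<Longrightarrow> d2 (\<Phi> x) (\<Phi> y) = d1 x y"
  using isometry unfolding isometry_map_def by blast

text \<open>Composing a geodesic path with \<open>\<Phi>\<close> leaves its parameter interval
  unchanged, because the end points keep their distance.\<close>

lemma geodesic_segment_image:
  assumes "X1.is_geodesic_segment G x y"
  shows "X2.is_geodesic_segment (\<Phi> ` G) (\<Phi> x) (\<Phi> y)"
proof -
  obtain c where c: "X1.geodesic_path c x y" and G: "G = c ` {0..d1 x y}"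
    using assms unfolding X1.is_geodesic_segment_def by blast
  note cD = X1.geodesic_pathD[OF c]
  have eq: "d2 (\<Phi> x) (\<Phi> y) = d1 x y"
    using cD(3,4) by (rule dist_image)
  have "X2.geodesic_path (\<Phi> \<circ> c) (\<Phi> x) (\<Phi> y)"
    unfolding X2.geodesic_path_def eq using cD by (auto simp: dist_image image_mem)
  then show ?thesis
    unfolding X2.is_geodesic_segment_def by (metis eq G image_comp)
qed

lemma closure_image:
  assumes complete: "X1.mcomplete" and A: "A \<subseteq> X1"
  shows "\<Phi> ` (X1.mtopology closure_of A) = X2.mtopology closure_of (\<Phi> ` A)"
proof
  \<comment> \<open>A point of \<open>A\<close> in the ball of radius \<open>r\<close> around
    \<open>x\<close> is sent into the ball of radius \<open>r\<close> around
    \<open>\<Phi> x\<close>.\<close>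
  show "\<Phi> ` (X1.mtopology closure_of A) \<subseteq> X2.mtopology closure_of (\<Phi> ` A)"
    using A image_mem dist_image
    by (force simp: X1.metric_closure_of X2.metric_closure_of)
  show "X2.mtopology closure_of (\<Phi> ` A) \<subseteq> \<Phi> ` (X1.mtopology closure_of A)"
  proof
    fix y assume "y \<in> X2.mtopology closure_of (\<Phi> ` A)"
    then obtain b where b: "range b \<subseteq> \<Phi> ` A \<inter> X2" and lim: "limitin X2.mtopology b y sequentially"
      unfolding X2.closure_of_sequentially by blast
    from b have "\<forall>n. \<exists>a\<in>A. b n = \<Phi> a" by blast
    then obtain a where a: "\<And>n. a n \<in> A" "\<And>n. b n = \<Phi> (a n)" by metis
    then have aX: "a n \<in> X1" for n using A by blast
    have "X2.MCauchy b"
      using lim b X2.convergent_imp_MCauchy by blast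
    \<comment> \<open>The Cauchy condition mentions mutual distances only, and these agree for
      \<open>a\<close> and \<open>b\<close>; completeness then supplies a limit in the
      domain.\<close>
    then have "X1.MCauchy a"
      unfolding X1.MCauchy_def X2.MCauchy_def using aX by (simp add: a(2) dist_image image_subset_iff)
    then obtain x where x: "limitin X1.mtopology a x sequentially"
      using complete unfolding X1.mcomplete_def by blast
    then have xX: "x \<in> X1" by (rule X1.limitin_mspace)
    have "x \<in> X1.mtopology closure_of A"
      unfolding X1.closure_of_sequentially using x xX a(1) aX by blast
    moreover have "limitin X2.mtopology b (\<Phi> x) sequentially"
      using x aX xX image_mem
      by (simp add: X1.limitin_metric X2.limitin_metric a(2) dist_image)
    then have "y = \<Phi> x"
      using lim X2.limitin_metric_unique trivial_limit_sequentially by blast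
    ultimately show "y \<in> \<Phi> ` (X1.mtopology closure_of A)" by blast
  qed
qed

end

context CAT0_space
begin

text \<open>Two applications of \<open>segment_subset\<close> with exchanged roles give uniqueness,
  so any segment that can be exhibited evaluates the definite description.\<close>

lemma segment_eq:
  assumes "is_geodesic_segment G x y"
  shows "segment x y = G"
  unfolding segment_def by (rule the_equality) (use assms segment_subset in blast)+

lemma segment_in_space:
  assumes "x \<in> M" "y \<in> M"
  shows "segment x y \<subseteq> M"
  using is_geodesic_segment_segment[OF assms]
  unfolding is_geodesic_segment_def geodesic_path_def by auto

lemma geod_convex_co:
  assumes "S \<subseteq> M"
  shows "geod_convex (co S)"
proof -
  \<comment> \<open>The hull is the intersection of all convex supersets. \<open>M\<close> is one of
    them; an empty family would yield \<open>UNIV\<close>.\<close>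
  have "geod_convex M"
    unfolding geod_convex_def using segment_in_space by blast
  with assms have "co S \<subseteq> M"
    unfolding co_def by (simp add: hull_minimal)
  then show ?thesis
    unfolding co_def hull_def geod_convex_def by blast
qed

end

locale CAT0_isometry = metric_isometry X1 d1 X2 d2 \<Phi> + X1: CAT0_space X1 d1 + X2: CAT0_space X2 d2
  for X1 :: "'a set" and d1 and X2 :: "'b set" and d2 and \<Phi>
begin

lemma segment_image:
  assumes "x \<in> X1" "y \<in> X1"
  shows "\<Phi> ` X1.segment x y = X2.segment (\<Phi> x) (\<Phi> y)"
  using geodesic_segment_image[OF X1.is_geodesic_segment_segment[OF assms]] X2.segment_eq by blast

lemma thr_image:
  assumes "S \<subseteq> X1"
  shows "\<Phi> ` X1.thr S = X2.thr (\<Phi> ` S)"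
proof -
  have "\<Phi> ` X1.segment x y = X2.segment (\<Phi> x) (\<Phi> y)" if "x \<in> S" "y \<in> S" for x y
    using assms that segment_image by blast
  then show ?thesis
    by (simp add: X1.thr_def X2.thr_def image_UN)
qed

lemma geod_convex_image:
  assumes "X1.geod_convex C"
  shows "X2.geod_convex (\<Phi> ` C)"
proof -
  have CX: "C \<subseteq> X1" and sub: "\<And>x y. x \<in> C \<Longrightarrow> y \<in> C \<Longrightarrow> X1.segment x y \<subseteq> C"
    using assms unfolding X1.geod_convex_def by blast+
  have "X2.segment (\<Phi> x) (\<Phi> y) \<subseteq> \<Phi> ` C" if "x \<in> C" "y \<in> C" for x y
  proof -
    have "X2.segment (\<Phi> x) (\<Phi> y) = \<Phi> ` X1.segment x y"
      using segment_image CX that by blast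
    then show ?thesis using sub[OF that] by blast
  qed
  then show ?thesis
    unfolding X2.geod_convex_def using CX image_mem by blast
qed

text \<open>The intersection with \<open>X1\<close> is there because \<open>\<Phi>\<close> is a
  total function whose values outside \<open>X1\<close> are arbitrary.\<close>

lemma geod_convex_preimage:
  assumes "X2.geod_convex C"
  shows "X1.geod_convex (X1 \<inter> \<Phi> -` C)"
proof -
  have "X1.segment x y \<subseteq> X1 \<inter> \<Phi> -` C"
    if "x \<in> X1" "y \<in> X1" "\<Phi> x \<in> C" "\<Phi> y \<in> C" for x y
  proof -
    have "\<Phi> ` X1.segment x y \<subseteq> C"
      using assms that unfolding segment_image[OF that(1,2)] X2.geod_convex_def by blast
    then show ?thesis using X1.segment_in_space[OF that(1,2)] by blast
  qed
  then show ?thesis unfolding X1.geod_convex_def by blast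
qed

text \<open>Each inclusion is minimality of one hull: the preimage of \<open>X2.co (\<Phi>\<close>
  S)\<open>is a convex superset of\<close>S\<open>, and the image of\<close>X1.co
  S\<open>is a convex superset of\<close>\<Phi> \<open>S\<close>.\<close>

lemma co_image:
  assumes "S \<subseteq> X1"
  shows "\<Phi> ` X1.co S = X2.co (\<Phi> ` S)"
proof
  have "\<Phi> ` S \<subseteq> X2" using assms image_mem by blast
  then have "X1.geod_convex (X1 \<inter> \<Phi> -` X2.co (\<Phi> ` S))"
    by (intro geod_convex_preimage X2.geod_convex_co)
  moreover have "S \<subseteq> X1 \<inter> \<Phi> -` X2.co (\<Phi> ` S)"
    using assms hull_subset[of "\<Phi> ` S" X2.geod_convex] unfolding X2.co_def by blast
  ultimately have "X1.co S \<subseteq> X1 \<inter> \<Phi> -` X2.co (\<Phi> ` S)"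
    unfolding X1.co_def by (intro hull_minimal)
  then show "\<Phi> ` X1.co S \<subseteq> X2.co (\<Phi> ` S)" by blast
  have "\<Phi> ` S \<subseteq> \<Phi> ` X1.co S"
    unfolding X1.co_def by (intro image_mono hull_subset)
  then show "X2.co (\<Phi> ` S) \<subseteq> \<Phi> ` X1.co S"
    using geod_convex_image[OF X1.geod_convex_co[OF assms]]
    unfolding X2.co_def by (rule hull_minimal)
qed

end

theorem proposition3:
  fixes X1 :: "'a set" and d1 :: "'a \<Rightarrow> 'a \<Rightarrow> real"
    and X2 :: "'b set" and d2 :: "'b \<Rightarrow> 'b \<Rightarrow> real"
    and \<Phi> :: "'a \<Rightarrow> 'b" and S :: "'a set"
  assumes "CAT0_space X1 d1" and "Metric_space.mcomplete X1 d1"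
    and "CAT0_space X2 d2" and "Metric_space.mcomplete X2 d2"
    and "isometry_map X1 d1 X2 d2 \<Phi>"
    and "S \<subseteq> X1"
  shows "\<Phi> ` Metric_space.thr X1 d1 S = Metric_space.thr X2 d2 (\<Phi> ` S) \<and>
    \<Phi> ` (Metric_space.mtopology X1 d1 closure_of Metric_space.co X1 d1 S) =
      Metric_space.mtopology X2 d2 closure_of Metric_space.co X2 d2 (\<Phi> ` S)"
proof -
  interpret X1: CAT0_space X1 d1 by fact
  interpret X2: CAT0_space X2 d2 by fact
  interpret CAT0_isometry X1 d1 X2 d2 \<Phi> by unfold_locales fact
  \<comment> \<open>This allows \<open>closure_image\<close> to be applied to the hull, after which
    \<open>co_image\<close> rewrites the image under the closure.\<close>
  have "X1.co S \<subseteq> X1"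
    using X1.geod_convex_co assms(6) unfolding X1.geod_convex_def by blast
  then show ?thesis
    using thr_image closure_image co_image assms(2,6) by simp
qed

end
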